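(* Let $(X_i)_{i\ge 1}$ be a sequence of i.i.d. real-valued random variables and let $\beta>1$. Assume that $\mathbb{E}[|X_1|^\beta]<\infty$, that $\mu=\mathbb{E}[X_1]<0$, and that $\mathbb{E}[e^{sX_1}]=\infty$ for every $s>0$. For $y>0$ let $M(y)=\sup_{n\ge 0}S_n(y)$, where $S_0(y)=0$ and $S_n(y)=\sum_{i=1}^n\min\{X_i,y\}$ for $n\ge 1$. Then there exists $y_\beta<\infty$ such that $$\mathbb{P}(M(y)>x)\le y^{-(\beta-1)x/y}\qquad\text{for all } x>0 \text{ and all } y>0 \text{ with } y>y_\beta .$$
   Context: The threshold $y_\beta$ is a constant that may depend on $\beta$ and on the distribution of $X_1$, but not on $x$ or $y$. *)

theory Defs
  imports "HOL-Probability.Probability"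
begin

text \<open>The sequence is indexed from 1, so \<open>X 0\<close> never enters; \<open>S\<^sub>0(y) = 0\<close> is the empty sum.\<close>

definition truncated_walk :: "(nat \<Rightarrow> 'a \<Rightarrow> real) \<Rightarrow> real \<Rightarrow> nat \<Rightarrow> 'a \<Rightarrow> real" where
  "truncated_walk X y n \<omega> = (\<Sum>i=1..n. min (X i \<omega>) y)"

text \<open>The supremum is taken in the extended reals: on \<^typ>\<open>real\<close>, \<^const>\<open>Sup\<close> of a set that is
  unbounded above is unspecified.\<close>

definition truncated_walk_sup :: "(nat \<Rightarrow> 'a \<Rightarrow> real) \<Rightarrow> real \<Rightarrow> 'a \<Rightarrow> ereal" where
  "truncated_walk_sup X y \<omega> = (SUP n. ereal (truncated_walk X y n \<omega>))"

end

theory Submission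
  imports Defs "HOL-Real_Asymp.Real_Asymp"
begin

text \<open>Put \<open>s = (\<beta> - 1) ln y / y\<close>, so that \<open>exp (s y) = y powr (\<beta> - 1)\<close> and the claimed bound is
  \<open>exp (- s x)\<close>. The quotients \<open>(exp (s min(X, y)) - 1) / s\<close> tend to \<open>X\<close> as \<open>y \<rightarrow> \<infinity>\<close> and are dominated
  by \<open>2 \<bar>X\<bar> + e \<bar>X\<bar> powr \<beta>\<close>, so their expectations converge to \<open>\<mu> < 0\<close>. Hence the exponential moment
  of a truncated step is at most 1 for large \<open>y\<close>, the process \<open>exp (s S\<^sub>n(y))\<close> is a supermartingale,
  and stopping it on first exceeding \<open>exp (s x)\<close> gives the bound.\<close>

section \<open>Pointwise domination of the exponential quotients\<close>

lemma abs_exp_minus_one_le: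
  fixes u :: real
  assumes "u \<le> 1"
  shows "\<bar>exp u - 1\<bar> \<le> 2 * \<bar>u\<bar>"
proof (cases "u \<ge> 0")
  case True
  then have "exp u \<le> 1 + u + u\<^sup>2"
    using assms by (intro exp_bound) auto
  moreover have "u\<^sup>2 \<le> u"
    using True assms by (simp add: power2_eq_square mult_left_le)
  ultimately show ?thesis
    using True by simp
next
  case False
  then have "exp u \<le> 1"
    by simp
  moreover have "1 + u \<le> exp u"
    by (rule exp_ge_add_one_self)
  ultimately show ?thesis
    using False by linarith
qed

text \<open>\<open>u - \<beta> ln u\<close> is convex, so a bound at both ends of \<open>[1, v]\<close> holds throughout.\<close>

lemma exp_le_mult_powr_interval:
  fixes u v K \<beta> :: real
  assumes "1 \<le> u" "u \<le> v" "0 \<le> \<beta>" "exp 1 \<le> K" "exp v \<le> K * v powr \<beta>"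
  shows "exp u \<le> K * u powr \<beta>"
proof (cases "v = 1")
  case True
  then show ?thesis using assms by auto
next
  case False
  define t where "t = (u - 1) / (v - 1)"
  have v: "v > 1" using False assms by auto
  have "t * (v - 1) = u - 1"
    using v by (simp add: t_def)
  then have t: "0 \<le> t" "t \<le> 1" "u = (1 - t) * 1 + t * v"
    using v assms(1,2) by (simp add: t_def, simp add: t_def, simp add: algebra_simps)
  have "K > 0"
    using assms(4) exp_gt_zero[of "1::real"] by linarith
  have "(1 - t) * ln 1 + t * ln v \<le> ln ((1 - t) *\<^sub>R 1 + t *\<^sub>R v)"
    using t v by (intro concave_onD[OF ln_concave]) auto
  then have 1: "t * ln v \<le> ln u" using t(3) by simp
  \<comment> \<open>Facts 2 and 3 are the two endpoint bounds in logarithmic form, with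
    \<open>\<beta> * ln 1\<close> vanishing on the left; they are then averaged with weights
    \<open>1 - t\<close> and \<open>t\<close>.\<close>
  have 2: "1 \<le> ln K"
    using assms(4) \<open>K > 0\<close> by (simp add: ln_ge_iff)
  have "exp v \<le> exp (ln K + \<beta> * ln v)"
    using assms(5) v \<open>K > 0\<close> by (simp add: exp_add powr_def)
  then have 3: "v \<le> ln K + \<beta> * ln v"
    by simp
  have "u = (1 - t) * 1 + t * v" by (fact t(3))
  also have "\<dots> \<le> (1 - t) * ln K + t * (ln K + \<beta> * ln v)"
    using t 2 3 by (intro add_mono mult_left_mono) auto
  also have "\<dots> = ln K + \<beta> * (t * ln v)"
    by (simp add: algebra_simps)
  also have "\<dots> \<le> ln K + \<beta> * ln u"
    using 1 assms(3) by (simp add: mult_left_mono)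
  finally have "exp u \<le> exp (ln K + \<beta> * ln u)"
    by simp
  then show ?thesis
    using \<open>K > 0\<close> assms(1) by (simp add: exp_add powr_def)
qed

text \<open>Where \<open>s * min x y\<close> is at most 1 a linear estimate suffices; beyond 1,
  convexity reduces the claim to the ends of the interval from 1 to \<open>s * y\<close>. The two
  conditions on \<open>s * y\<close> serve the right end, where
  \<open>exp (s * y) = y powr \<beta> / y\<close> and \<open>1 / y \<le> exp 1 * s\<close>. The
  majorant is free of \<open>s\<close> and \<open>y\<close>, as dominated convergence
  requires.\<close>

lemma exp_min_quotient_bound:
  fixes \<beta> s x y :: real
  assumes "\<beta> > 1" "0 < s" "s \<le> 1" "0 < y"
    and sy: "exp (s * y) = y powr (\<beta> - 1)" "1 \<le> exp 1 * (s * y)"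
  shows "\<bar>(exp (s * min x y) - 1) / s\<bar> \<le> 2 * \<bar>x\<bar> + exp 1 * \<bar>x\<bar> powr \<beta>"
proof -
  define m where "m = min x y"
  have m: "m \<le> y" "\<bar>m\<bar> \<le> \<bar>x\<bar>"
    using assms by (auto simp: m_def)
  show ?thesis
  proof (cases "s * m \<le> 1")
    case True
    then have "\<bar>(exp (s * m) - 1) / s\<bar> \<le> 2 * \<bar>m\<bar>"
      using abs_exp_minus_one_le[of "s * m"] assms
      by (simp add: abs_mult divide_le_eq mult.commute mult.left_commute)
    also have "\<dots> \<le> 2 * \<bar>x\<bar> + exp 1 * \<bar>x\<bar> powr \<beta>"
      using m by (intro add_increasing2) auto
    finally show ?thesis by (simp add: m_def)
  next
    case False
    \<comment> \<open>For \<open>z > 0\<close> this makes \<open>K * (s * z) powr \<beta>\<close> a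
      multiple of \<open>s\<close>, so that division by \<open>s\<close> leaves a bound without
      \<open>s\<close>. From \<open>s \<le> 1\<close> and \<open>\<beta> > 1\<close> comes
      \<open>exp 1 \<le> K\<close>, the condition at the left end.\<close>
    define K where "K = exp 1 * s powr (1 - \<beta>)"
    have "m > 0"
      using False assms by (smt (verit) mult_nonneg_nonpos)
    have "ln s * (1 - \<beta>) \<ge> 0"
      using assms by (intro mult_nonpos_nonpos) auto
    then have "s powr (1 - \<beta>) \<ge> 1"
      using assms by (simp add: powr_def mult.commute)
    then have K: "exp 1 \<le> K"
      by (simp add: K_def)
    have K_powr: "K * (s * z) powr \<beta> = s * (exp 1 * z powr \<beta>)" if "z > 0" for z
      using assms that powr_add[of s "1 - \<beta>" \<beta>] by (simp add: K_def powr_mult)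
    have "exp (s * y) = y powr \<beta> / y"
      using assms by (simp add: sy(1) powr_diff)
    also have "\<dots> \<le> y powr \<beta> / y * (exp 1 * (s * y))"
      using mult_left_mono[OF sy(2), of "y powr \<beta> / y"] assms(4) by simp
    also have "\<dots> = K * (s * y) powr \<beta>"
      using assms by (simp add: K_powr)
    finally have "exp (s * m) \<le> K * (s * m) powr \<beta>"
      using False m assms K by (intro exp_le_mult_powr_interval[of "s * m" "s * y"]) auto
    also have "\<dots> = s * (exp 1 * m powr \<beta>)"
      using \<open>m > 0\<close> by (rule K_powr)
    finally have "(exp (s * m) - 1) / s \<le> exp 1 * m powr \<beta>"
      using assms by (simp add: divide_le_eq mult.commute)
    moreover have "(exp (s * m) - 1) / s \<ge> 0"
      using \<open>m > 0\<close> assms by simp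
    ultimately have "\<bar>(exp (s * m) - 1) / s\<bar> \<le> exp 1 * m powr \<beta>"
      by linarith
    also have "\<dots> \<le> exp 1 * \<bar>x\<bar> powr \<beta>"
      using m \<open>m > 0\<close> assms by (simp add: powr_mono2)
    finally show ?thesis by (simp add: m_def)
  qed
qed

section \<open>Exponential moments of the truncated step\<close>

lemma (in prob_space) integrable_of_integrable_abs_powr:
  fixes f :: "'a \<Rightarrow> real"
  assumes "f \<in> borel_measurable M" "1 \<le> \<beta>" "integrable M (\<lambda>\<omega>. \<bar>f \<omega>\<bar> powr \<beta>)"
  shows "integrable M f"
proof (rule Bochner_Integration.integrable_bound)
  \<comment> \<open>The constant covers values of modulus at most 1, where the power can be the
    smaller one; it is integrable because the measure is finite.\<close>
  show "integrable M (\<lambda>\<omega>. 1 + \<bar>f \<omega>\<bar> powr \<beta>)"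
    using assms by simp
  have "\<bar>z\<bar> \<le> 1 + \<bar>z\<bar> powr \<beta>" for z :: real
  proof (cases "\<bar>z\<bar> \<le> 1")
    case False
    then have "\<bar>z\<bar> powr 1 \<le> \<bar>z\<bar> powr \<beta>"
      using assms by (intro powr_mono) auto
    then show ?thesis by simp
  qed (simp add: add_increasing2)
  then show "AE \<omega> in M. norm (f \<omega>) \<le> norm (1 + \<bar>f \<omega>\<bar> powr \<beta>)"
    by (auto simp: abs_of_nonneg)
qed (use assms in auto)

lemma (in prob_space) eventually_expectation_exp_min_le_one:
  fixes f :: "'a \<Rightarrow> real"
  assumes f[measurable]: "f \<in> borel_measurable M" and \<beta>: "\<beta> > 1"
    and int: "integrable M (\<lambda>\<omega>. \<bar>f \<omega>\<bar> powr \<beta>)" and neg: "expectation f < 0"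
  shows "\<forall>\<^sub>F y in at_top.
    (\<integral>\<^sup>+\<omega>. ennreal (exp ((\<beta> - 1) * ln y / y * min (f \<omega>) y)) \<partial>M) \<le> 1"
proof -
  define s where "s y = (\<beta> - 1) * ln y / y" for y :: real
  have s0: "(s \<longlongrightarrow> 0) at_top"
    unfolding s_def by real_asymp
  have s_pos: "\<forall>\<^sub>F y in at_top. 0 < s y"
    unfolding s_def using \<beta> by real_asymp
  have s_le: "\<forall>\<^sub>F y in at_top. s y \<le> 1"
    unfolding s_def by real_asymp
  have sy: "\<forall>\<^sub>F y in at_top. 1 \<le> exp 1 * ((\<beta> - 1) * ln y)"
    using \<beta> by real_asymp
  \<comment> \<open>These are the conditions of the pointwise bound; the last one holds eventually
    because \<open>s y * y = (\<beta> - 1) * ln y\<close> tends to infinity.\<close>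
  have good: "\<forall>\<^sub>F y in at_top. 0 < s y \<and> s y \<le> 1 \<and> 0 < y \<and>
      exp (s y * y) = y powr (\<beta> - 1) \<and> 1 \<le> exp 1 * (s y * y)"
    using s_pos s_le sy eventually_gt_at_top[of 0]
    by eventually_elim (auto simp: s_def powr_def)
  have "((\<lambda>y. expectation (\<lambda>\<omega>. (exp (s y * min (f \<omega>) y) - 1) / s y)) \<longlongrightarrow> expectation f) at_top"
  proof (rule integral_dominated_convergence_at_top)
    show "integrable M (\<lambda>\<omega>. 2 * \<bar>f \<omega>\<bar> + exp 1 * \<bar>f \<omega>\<bar> powr \<beta>)"
      using int integrable_of_integrable_abs_powr[OF f _ int] \<beta> by simp
    show "\<forall>\<^sub>F y in at_top. AE \<omega> in M. norm ((exp (s y * min (f \<omega>) y) - 1) / s y)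
        \<le> 2 * \<bar>f \<omega>\<bar> + exp 1 * \<bar>f \<omega>\<bar> powr \<beta>"
      using good
      by eventually_elim (auto simp del: abs_divide intro!: AE_I2 exp_min_quotient_bound[OF \<beta>])
    \<comment> \<open>For fixed \<open>z\<close> the truncation is inactive once
      \<open>y \<ge> z\<close>; what remains is the derivative of \<open>exp (h * z)\<close> at
      \<open>h = 0\<close>, taken along \<open>h = s y\<close>.\<close>
    have "((\<lambda>y. (exp (s y * min z y) - 1) / s y) \<longlongrightarrow> z) at_top" for z
    proof -
      have "((\<lambda>h. (exp (h * z) - 1) / h) \<longlongrightarrow> z) (at_right 0)"
        by real_asymp
      moreover have "filterlim s (at_right 0) at_top"
        using s0 s_pos by (intro filterlim_at_withinI) (auto elim: eventually_mono)
      ultimately have "((\<lambda>y. (exp (s y * z) - 1) / s y) \<longlongrightarrow> z) at_top"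
        by (rule filterlim_compose)
      moreover have "\<forall>\<^sub>F y in at_top. (exp (s y * z) - 1) / s y = (exp (s y * min z y) - 1) / s y"
        using eventually_ge_at_top[of z] by eventually_elim simp
      ultimately show ?thesis
        by (rule Lim_transform_eventually)
    qed
    then show "AE \<omega> in M. ((\<lambda>y. (exp (s y * min (f \<omega>) y) - 1) / s y) \<longlongrightarrow> f \<omega>) at_top"
      by simp
  qed measurable
  then have "\<forall>\<^sub>F y in at_top. expectation (\<lambda>\<omega>. (exp (s y * min (f \<omega>) y) - 1) / s y) < 0"
    using neg by (rule order_tendstoD)
  with good show ?thesis
  proof eventually_elim
    case (elim y)
    \<comment> \<open>Truncation bounds the exponential, so its expectation is finite and the
      constant 1 can be split off.\<close>
    have "exp (s y * min (f \<omega>) y) \<le> exp (s y * y)" for \<omega>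
      unfolding exp_le_cancel_iff using elim by (intro mult_left_mono) auto
    then have *: "integrable M (\<lambda>\<omega>. exp (s y * min (f \<omega>) y))"
      by (intro integrable_const_bound[where B = "exp (s y * y)"]) (auto simp del: exp_le_cancel_iff)
    then have "(expectation (\<lambda>\<omega>. exp (s y * min (f \<omega>) y)) - 1) / s y < 0"
      using elim by (simp add: prob_space)
    then have "expectation (\<lambda>\<omega>. exp (s y * min (f \<omega>) y)) \<le> 1"
      using elim by (simp add: divide_less_0_iff)
    then have "(\<integral>\<^sup>+\<omega>. ennreal (exp (s y * min (f \<omega>) y)) \<partial>M) \<le> 1"
      using * by (subst nn_integral_eq_integral) (auto simp: ennreal_le_1)
    then show ?case
      by (simp add: s_def)
  qed
qed

section \<open>The stopped exponential supermartingale\<close>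

lemma (in prob_space) indep_var_nn_integral_mult:
  fixes f g :: "_ \<Rightarrow> ennreal"
  assumes "indep_var S X T Y" "f \<in> borel_measurable S" "g \<in> borel_measurable T"
  shows "(\<integral>\<^sup>+\<omega>. f (X \<omega>) * g (Y \<omega>) \<partial>M) = (\<integral>\<^sup>+\<omega>. f (X \<omega>) \<partial>M) * (\<integral>\<^sup>+\<omega>. g (Y \<omega>) \<partial>M)"
proof -
  have "indep_var borel (f \<circ> X) borel (g \<circ> Y)"
    using assms by (rule indep_var_compose)
  \<comment> \<open>The pair becomes a family over \<open>bool\<close> with a constant target space,
    to which the product rule for finite independent families applies.\<close>
  then have "indep_vars (\<lambda>_. borel) (case_bool (f \<circ> X) (g \<circ> Y)) UNIV"
    unfolding indep_var_def by (rule indep_vars_cong[THEN iffD1, rotated -1]) (auto split: bool.split)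
  from indep_vars_nn_integral[OF _ this] show ?thesis
    by (simp add: UNIV_bool mult.commute comp_def)
qed

text \<open>\<^term>\<open>stopped_exp s x n a\<close> is \<open>exp (s * S\<^sub>\<tau>)\<close> for the walk \<open>S\<close> with steps \<open>a 1, a 2, \<dots>\<close>,
  where \<open>\<tau>\<close> is the minimum of \<open>n\<close> and the first time that \<open>S\<close> exceeds \<open>x\<close>.\<close>

primrec stopped_exp :: "real \<Rightarrow> real \<Rightarrow> nat \<Rightarrow> (nat \<Rightarrow> real) \<Rightarrow> real" where
  "stopped_exp s x 0 a = 1"
| "stopped_exp s x (Suc n) a = (if \<exists>k\<le>n. sum a {1..k} > x then stopped_exp s x n a
     else stopped_exp s x n a * exp (s * a (Suc n)))"

lemma stopped_exp_nonneg: "stopped_exp s x n a \<ge> 0"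
  by (induction n) auto

text \<open>Adaptedness: the value at time \<open>n\<close> is determined by the first
  \<open>n\<close> steps, which makes it independent of the next one.\<close>

lemma stopped_exp_cong:
  assumes "\<And>i. i \<in> {1..n} \<Longrightarrow> a i = b i"
  shows "stopped_exp s x n a = stopped_exp s x n b"
  using assms
proof (induction n)
  case (Suc n)
  have "sum a {1..k} = sum b {1..k}" if "k \<le> n" for k
    using that Suc.prems by (intro sum.cong) auto
  then have "(\<exists>k\<le>n. sum a {1..k} > x) \<longleftrightarrow> (\<exists>k\<le>n. sum b {1..k} > x)"
    by auto
  moreover have "stopped_exp s x n a = stopped_exp s x n b"
    using Suc by auto
  ultimately show ?case
    using Suc.prems by (auto simp del: One_nat_def)
qed simp

text \<open>Only passages strictly before \<open>n\<close> freeze the value: if the walk first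
  exceeds \<open>x\<close> at time \<open>n\<close>, that step has still been taken.\<close>

lemma stopped_exp_eq:
  assumes "\<not> (\<exists>k<n. sum a {1..k} > x)"
  shows "stopped_exp s x n a = exp (s * sum a {1..n})"
  using assms
proof (induction n)
  case (Suc n)
  then have "\<not> (\<exists>k\<le>n. sum a {1..k} > x)"
    by (auto simp: less_Suc_eq_le)
  moreover have "stopped_exp s x n a = exp (s * sum a {1..n})"
    using Suc by auto
  ultimately show ?case
    by (auto simp: exp_add distrib_left)
qed simp

text \<open>At the first passage the value is \<open>exp (s * S)\<close> with \<open>S > x\<close>,
  and it stays frozen from then on.\<close>

lemma stopped_exp_ge:
  assumes "s \<ge> 0" "\<exists>k\<le>n. sum a {1..k} > x"
  shows "stopped_exp s x n a \<ge> exp (s * x)"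
  using assms(2)
proof (induction n)
  case 0
  then have "x \<le> 0" by simp
  then show ?case using assms(1) by (simp add: mult_nonneg_nonpos)
next
  case (Suc n)
  show ?case
  proof (cases "\<exists>k\<le>n. sum a {1..k} > x")
    case False
    then have "stopped_exp s x (Suc n) a = exp (s * sum a {1..Suc n})"
      by (intro stopped_exp_eq) (auto simp: less_Suc_eq_le)
    moreover have "x < sum a {1..Suc n}"
      using False Suc.prems by (auto simp: le_Suc_eq)
    ultimately show ?thesis
      using assms(1) by (simp add: mult_left_mono)
  qed (use Suc.IH in auto)
qed

text \<open>The index set is any superset of \<open>{1..n}\<close>, so that it can stay fixed while
  \<open>n\<close> decreases in the induction.\<close>

lemma measurable_stopped_exp[measurable]:
  assumes "{1..n} \<subseteq> I"
  shows "stopped_exp s x n \<in> borel_measurable (PiM I (\<lambda>_. borel))"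
  using assms
proof (induction n)
  case (Suc n)
  then have "{1..n} \<subseteq> I" "Suc n \<in> I" by auto
  have stopped[measurable]: "stopped_exp s x n \<in> borel_measurable (PiM I (\<lambda>_. borel))"
    using Suc.IH \<open>{1..n} \<subseteq> I\<close> by blast
  have [measurable]: "(\<lambda>a. sum a {1..k}) \<in> borel_measurable (PiM I (\<lambda>_. borel :: real measure))"
    if "k \<in> {..n}" for k
    using that \<open>{1..n} \<subseteq> I\<close> by (intro borel_measurable_sum measurable_component_singleton) auto
  have "Measurable.pred (PiM I (\<lambda>_. borel)) (\<lambda>a. \<exists>k\<in>{..n}. sum a {1..k} > x)"
    by measurable
  then have hit: "{a \<in> space (PiM I (\<lambda>_. borel)). \<exists>k\<le>n. sum a {1..k} > x}
      \<in> sets (PiM I (\<lambda>_. borel))"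
    by (simp only: pred_def Bex_def atMost_iff)
  have [measurable]: "(\<lambda>a. a (Suc n)) \<in> borel_measurable (PiM I (\<lambda>_. borel))"
    using \<open>Suc n \<in> I\<close> by simp
  have "(\<lambda>a. stopped_exp s x n a * exp (s * a (Suc n))) \<in> borel_measurable (PiM I (\<lambda>_. borel))"
    by measurable
  with stopped hit show ?case
    unfolding stopped_exp.simps by (intro measurable_If)
qed (simp add: stopped_exp.simps(1)[abs_def])

lemma (in prob_space) nn_integral_stopped_exp_le_one:
  assumes indep: "indep_vars (\<lambda>_. borel) Y {1..}"
    and le_one: "\<And>i. i \<ge> 1 \<Longrightarrow> (\<integral>\<^sup>+\<omega>. ennreal (exp (s * Y i \<omega>)) \<partial>M) \<le> 1"
  shows "(\<integral>\<^sup>+\<omega>. ennreal (stopped_exp s x n (\<lambda>i. Y i \<omega>)) \<partial>M) \<le> 1"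
proof (induction n)
  case 0
  then show ?case by (simp add: emeasure_space_1)
next
  case (Suc n)
  define R where "R \<omega> = restrict (\<lambda>i. Y i \<omega>) {1..n}" for \<omega>
  define Q where "Q \<omega> = restrict (\<lambda>i. Y i \<omega>) {Suc n}" for \<omega>
  let ?P = "PiM {1..n} (\<lambda>_. borel) :: (nat \<Rightarrow> real) measure"
  have ind: "indep_var ?P R (PiM {Suc n} (\<lambda>_. borel)) Q"
    unfolding R_def Q_def using indep by (rule indep_var_restrict) auto
  note [measurable] = indep_var_rv1[OF ind] indep_var_rv2[OF ind]
  let ?hit = "\<lambda>a. \<exists>k\<in>{..n}. x < sum a {1..k}"
  \<comment> \<open>The integrand is split by whether the walk has passed \<open>x\<close> by time
    \<open>n\<close>: \<open>h\<close> is frozen, while \<open>f\<close> gets multiplied by an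
    independent factor of mean at most 1.\<close>
  define f where "f a = (if ?hit a then 0 else ennreal (stopped_exp s x n a))" for a
  define h where "h a = (if ?hit a then ennreal (stopped_exp s x n a) else 0)" for a
  have [measurable]: "(\<lambda>a. sum a {1..k}) \<in> borel_measurable ?P" if "k \<in> {..n}" for k
    using that by (intro borel_measurable_sum) auto
  have [measurable]: "f \<in> borel_measurable ?P" "h \<in> borel_measurable ?P"
    unfolding f_def h_def by measurable
  have [measurable]: "(\<lambda>a. ennreal (exp (s * a (Suc n)))) \<in> borel_measurable (PiM {Suc n} (\<lambda>_. borel))"
    by measurable
  have sum_R: "sum (R \<omega>) {1..k} = (\<Sum>i=1..k. Y i \<omega>)" if "k \<le> n" for k \<omega>
    using that by (intro sum.cong) (auto simp: R_def)
  have exp_R: "stopped_exp s x n (R \<omega>) = stopped_exp s x n (\<lambda>i. Y i \<omega>)" for \<omega>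
    by (rule stopped_exp_cong) (simp add: R_def)
  have "(\<integral>\<^sup>+\<omega>. ennreal (stopped_exp s x (Suc n) (\<lambda>i. Y i \<omega>)) \<partial>M)
      = (\<integral>\<^sup>+\<omega>. h (R \<omega>) + f (R \<omega>) * ennreal (exp (s * Q \<omega> (Suc n))) \<partial>M)"
    by (intro nn_integral_cong)
      (auto simp: f_def h_def exp_R sum_R Q_def ennreal_mult stopped_exp_nonneg simp del: One_nat_def)
  also have "\<dots> = (\<integral>\<^sup>+\<omega>. h (R \<omega>) \<partial>M) + (\<integral>\<^sup>+\<omega>. f (R \<omega>) * ennreal (exp (s * Q \<omega> (Suc n))) \<partial>M)"
    by (intro nn_integral_add) measurable
  also have "(\<integral>\<^sup>+\<omega>. f (R \<omega>) * ennreal (exp (s * Q \<omega> (Suc n))) \<partial>M)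
      = (\<integral>\<^sup>+\<omega>. f (R \<omega>) \<partial>M) * (\<integral>\<^sup>+\<omega>. ennreal (exp (s * Q \<omega> (Suc n))) \<partial>M)"
    by (rule indep_var_nn_integral_mult[OF ind]) measurable
  also have "(\<integral>\<^sup>+\<omega>. h (R \<omega>) \<partial>M)
        + (\<integral>\<^sup>+\<omega>. f (R \<omega>) \<partial>M) * (\<integral>\<^sup>+\<omega>. ennreal (exp (s * Q \<omega> (Suc n))) \<partial>M)
      \<le> (\<integral>\<^sup>+\<omega>. h (R \<omega>) \<partial>M) + (\<integral>\<^sup>+\<omega>. f (R \<omega>) \<partial>M) * 1"
    using le_one[of "Suc n"] by (intro add_left_mono mult_left_mono) (auto simp: Q_def)
  also have "(\<integral>\<^sup>+\<omega>. h (R \<omega>) \<partial>M) + (\<integral>\<^sup>+\<omega>. f (R \<omega>) \<partial>M) * 1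
      = (\<integral>\<^sup>+\<omega>. h (R \<omega>) + f (R \<omega>) \<partial>M)"
    by (simp add: nn_integral_add)
  also have "\<dots> = (\<integral>\<^sup>+\<omega>. ennreal (stopped_exp s x n (\<lambda>i. Y i \<omega>)) \<partial>M)"
    by (intro nn_integral_cong) (simp add: f_def h_def exp_R)
  also have "\<dots> \<le> 1"
    by (fact Suc.IH)
  finally show ?case .
qed

section \<open>Maximal inequality and conclusion\<close>

lemma (in prob_space) prob_partial_sum_exceeds_le:
  fixes Y :: "nat \<Rightarrow> 'a \<Rightarrow> real"
  assumes indep: "indep_vars (\<lambda>_. borel) Y {1..}" and "s \<ge> 0"
    and le_one: "\<And>i. i \<ge> 1 \<Longrightarrow> (\<integral>\<^sup>+\<omega>. ennreal (exp (s * Y i \<omega>)) \<partial>M) \<le> 1"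
  shows "prob {\<omega> \<in> space M. \<exists>n. (\<Sum>i=1..n. Y i \<omega>) > x} \<le> exp (- s * x)"
proof -
  define A where "A n = {\<omega> \<in> space M. \<exists>k\<in>{..n}. (\<Sum>i=1..k. Y i \<omega>) > x}" for n
  have rv[measurable]: "Y i \<in> borel_measurable M" if "i \<ge> 1" for i
    using indep that by (auto simp: indep_vars_def)
  have [measurable]: "(\<lambda>\<omega>. \<Sum>i=1..k. Y i \<omega>) \<in> borel_measurable M" for k
    by (intro borel_measurable_sum) auto
  have A[measurable]: "A n \<in> sets M" for n
    unfolding A_def by measurable
  have "prob (A n) \<le> exp (- s * x)" for n
  proof -
    let ?Z = "\<lambda>\<omega>. ennreal (stopped_exp s x n (\<lambda>i. Y i \<omega>))"
    have eq: "stopped_exp s x n (\<lambda>i. Y i \<omega>) = stopped_exp s x n (restrict (\<lambda>i. Y i \<omega>) {1..n})" for \<omega>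
      by (rule stopped_exp_cong) simp
    have "(\<lambda>\<omega>. restrict (\<lambda>i. Y i \<omega>) {1..n}) \<in> measurable M (PiM {1..n} (\<lambda>_. borel))"
      by (intro measurable_restrict rv) auto
    from measurable_compose[OF this measurable_stopped_exp[OF order_refl]]
    have [measurable]: "?Z \<in> borel_measurable M"
      unfolding eq by measurable
    \<comment> \<open>Markov's inequality for the stopped value at time \<open>n\<close>.\<close>
    have "ennreal (exp (s * x)) * indicator (A n) \<omega> \<le> ?Z \<omega>" for \<omega>
      using stopped_exp_ge[OF \<open>s \<ge> 0\<close>, of n x "\<lambda>i. Y i \<omega>"]
      by (auto simp: A_def indicator_def intro: ennreal_leI)
    then have "(\<integral>\<^sup>+\<omega>. ennreal (exp (s * x)) * indicator (A n) \<omega> \<partial>M) \<le> (\<integral>\<^sup>+\<omega>. ?Z \<omega> \<partial>M)"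
      by (intro nn_integral_mono)
    also have "\<dots> \<le> 1"
      using indep le_one by (rule nn_integral_stopped_exp_le_one)
    finally have "ennreal (exp (s * x) * prob (A n)) \<le> ennreal 1"
      by (simp add: nn_integral_cmult_indicator emeasure_eq_measure ennreal_mult)
    then have "exp (s * x) * prob (A n) \<le> 1"
      by (subst (asm) ennreal_le_iff) auto
    then show ?thesis
      by (simp add: exp_minus field_simps)
  qed
  \<comment> \<open>The bound is uniform in \<open>n\<close> and the events increase, so continuity
    from below removes the time horizon.\<close>
  moreover have "(\<lambda>n. prob (A n)) \<longlonglongrightarrow> prob (\<Union>n. A n)"
    using A by (intro finite_Lim_measure_incseq) (force simp: A_def incseq_def)+
  ultimately have "prob (\<Union>n. A n) \<le> exp (- s * x)"
    by (intro LIMSEQ_le_const2) auto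
  moreover have "(\<Union>n. A n) = {\<omega> \<in> space M. \<exists>n. (\<Sum>i=1..n. Y i \<omega>) > x}"
    by (auto simp: A_def)
  ultimately show ?thesis by simp
qed

theorem theorem1p1:
  fixes M :: "'a measure" and X :: "nat \<Rightarrow> 'a \<Rightarrow> real" and \<beta> :: real
  assumes "prob_space M"
    and "prob_space.indep_vars M (\<lambda>_. borel) X {1..}"
    and "\<And>i. i \<ge> 1 \<Longrightarrow> distr M borel (X i) = distr M borel (X 1)"
    and "\<beta> > 1"
    and "integrable M (\<lambda>\<omega>. \<bar>X 1 \<omega>\<bar> powr \<beta>)"
    and "(\<integral>\<omega>. X 1 \<omega> \<partial>M) < 0"
    and "\<And>s::real. s > 0 \<Longrightarrow> (\<integral>\<^sup>+\<omega>. ennreal (exp (s * X 1 \<omega>)) \<partial>M) = \<infinity>"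
  shows "\<exists>y\<^sub>\<beta>::real. \<forall>x::real. \<forall>y::real. x > 0 \<longrightarrow> y > 0 \<longrightarrow> y > y\<^sub>\<beta> \<longrightarrow>
    measure M {\<omega> \<in> space M. truncated_walk_sup X y \<omega> > ereal x} \<le> y powr (- (\<beta> - 1) * x / y)"
proof -
  interpret prob_space M by fact
  have rv[measurable]: "X i \<in> borel_measurable M" if "i \<ge> 1" for i
    using assms(2) that by (auto simp: indep_vars_def)
  obtain y0 where y0: "\<And>y. y \<ge> y0 \<Longrightarrow>
      (\<integral>\<^sup>+\<omega>. ennreal (exp ((\<beta> - 1) * ln y / y * min (X 1 \<omega>) y)) \<partial>M) \<le> 1"
    using eventually_expectation_exp_min_le_one[OF rv assms(4,5,6)]
    by (auto simp: eventually_at_top_linorder)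
  \<comment> \<open>Above \<open>max 1 y0\<close>, \<open>ln y\<close> is positive, hence
    \<open>s \<ge> 0\<close>, and the moment bound holds; this threshold is fixed before
    \<open>x\<close> and \<open>y\<close>.\<close>
  have "prob {\<omega> \<in> space M. truncated_walk_sup X y \<omega> > ereal x} \<le> y powr (- (\<beta> - 1) * x / y)"
    if y: "y > max 1 y0" for x y
  proof -
    define s where "s = (\<beta> - 1) * ln y / y"
    have "s \<ge> 0"
      using y assms(4) by (simp add: s_def)
    have indep: "indep_vars (\<lambda>_. borel) (\<lambda>i \<omega>. min (X i \<omega>) y) {1..}"
      using assms(2) by (rule indep_vars_compose2) simp
    have le_one: "(\<integral>\<^sup>+\<omega>. ennreal (exp (s * min (X i \<omega>) y)) \<partial>M) \<le> 1" if "i \<ge> 1" for i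
    proof -
      \<comment> \<open>The moment depends only on the law of the step, so the bound for
        \<open>X 1\<close> transfers to every \<open>X i\<close>.\<close>
      have "(\<integral>\<^sup>+\<omega>. ennreal (exp (s * min (X j \<omega>) y)) \<partial>M)
          = (\<integral>\<^sup>+z. ennreal (exp (s * min z y)) \<partial>distr M borel (X j))" if "j \<ge> 1" for j
        using rv[OF that] by (subst nn_integral_distr) simp_all
      from this[of i] this[of 1] show ?thesis
        using y0[of y] y that assms(3)[OF that] by (simp add: s_def)
    qed
    \<comment> \<open>A supremum exceeds \<open>x\<close> strictly exactly when some partial sum
      does, also when it is infinite.\<close>
    have "prob {\<omega> \<in> space M. truncated_walk_sup X y \<omega> > ereal x}
        = prob {\<omega> \<in> space M. \<exists>n. (\<Sum>i=1..n. min (X i \<omega>) y) > x}"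
      by (simp add: truncated_walk_sup_def truncated_walk_def less_SUP_iff)
    also have "\<dots> \<le> exp (- s * x)"
      using indep \<open>s \<ge> 0\<close> le_one by (rule prob_partial_sum_exceeds_le)
    also have "\<dots> = y powr (- (\<beta> - 1) * x / y)"
      using y by (simp add: s_def powr_def field_simps)
    finally show ?thesis .
  qed
  then show ?thesis
    by (intro exI[of _ "max 1 y0"]) auto
qed

end
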